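(* Let $\alpha,\beta\ge 0$ and $C>0$. There exists a constant $c>0$, depending only on $C$, $\alpha$ and $\beta$, such that the following holds. Let $f:\mathbb{R}^4\to\mathbb{R}$, $(v,\tau,u,t)\mapsto f(v,\tau,u,t)$, satisfy: (A1) $f$ is bounded and Lipschitz continuous, with Lipschitz constant $\alpha$ and $\|f\|_{L^\infty(\mathbb{R}^4)}=\beta$; (A2) $f(v+l,\tau+k,u,t)=f(v,\tau,u,t)$ for all $(v,\tau,u,t)\in\mathbb{R}^4$ and all $(l,k)\in\mathbb{Z}^2$; (A3) for every $(v,\tau,t)\in\mathbb{R}^3$ the function $u\mapsto f(v,\tau,u,t)$ is non-increasing. Let $u_0\in\mathbb{R}$ and $0<\varepsilon<1$. Let $u^\varepsilon$ be the solution of $$u^\varepsilon_t=f\left(\frac{u^\varepsilon}{\varepsilon},\frac{t}{\varepsilon},u^\varepsilon,t\right)\ (t>0),\qquad u^\varepsilon(0)=u_0,$$ and let $u^0\in C^1([0,\infty);\mathbb{R})$ be the (unique) solution of the homogenized equation $$u^0_t=\overline f(u^0,t)\ (t>0),\qquad u^0(0)=u_0,$$ where $\overline f$ is the effective slope of $f$. Then for every $T\ge C\varepsilon|\log\varepsilon|$, $$\|u^\varepsilon-u^0\|_{L^\infty(0,T)}\le\frac{cT}{|\log\varepsilon|}.$$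
   Context: Effective slope: for $f$ satisfying (A1) and (A2) and for fixed $(u,t)\in\mathbb{R}^2$, there is a real number $\lambda$ such that for every initial value $v_0\in\mathbb{R}$ the solution $v\in C^1([0,\infty);\mathbb{R})$ of $v_\tau=f(v,\tau,u,t)$ for $\tau>0$, $v(0)=v_0$ (with $u,t$ frozen) satisfies $v(\tau)/\tau\to\lambda$ as $\tau\to\infty$. One sets $\overline f(u,t)=\lambda$. If (A3) also holds, $\overline f$ is continuous on $\mathbb{R}^2$ and $u\mapsto\overline f(u,t)$ is non-increasing, and the homogenized Cauchy problem has a unique $C^1$ solution on $[0,\infty)$. *)

theory Defs
  imports "HOL-Analysis.Analysis" "HOL-Probability.Essential_Supremum"
begin

definition Linf_norm :: "'a::euclidean_space set \<Rightarrow> ('a \<Rightarrow> real) \<Rightarrow> ereal" where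
  "Linf_norm S f = esssup (lebesgue_on S) (\<lambda>x. ereal \<bar>f x\<bar>)"

(* C^1([0,\<infinity>); R): the derivative at 0 is one-sided; values at negative arguments are irrelevant. *)
definition C1_half_line :: "(real \<Rightarrow> real) \<Rightarrow> bool" where
  "C1_half_line x \<longleftrightarrow>
     (\<exists>x'. (\<forall>s\<ge>0. (x has_real_derivative x' s) (at s within {0..})) \<and> continuous_on {0..} x')"

(* x' = g(x,s) for s > 0, x(0) = x0; the state comes first in g, then the time. *)
definition solves_cauchy :: "(real \<Rightarrow> real \<Rightarrow> real) \<Rightarrow> real \<Rightarrow> (real \<Rightarrow> real) \<Rightarrow> bool" where
  "solves_cauchy g x0 x \<longleftrightarrow>
     C1_half_line x \<and> (\<forall>s>0. (x has_real_derivative g (x s) s) (at s)) \<and> x 0 = x0"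

(* The arguments of f are ordered (v, \<tau>, u, t), and u, t are frozen. "The" solution is rendered by
   quantifying over all v solving the problem, since a total function v is determined only on
   [0,\<infinity>). *)
definition effective_slope :: "(real \<times> real \<times> real \<times> real \<Rightarrow> real) \<Rightarrow> real \<Rightarrow> real \<Rightarrow> real" where
  "effective_slope f u t =
     (THE l. \<forall>v0 v. solves_cauchy (\<lambda>y \<tau>. f (y, \<tau>, u, t)) v0 v
                \<longrightarrow> ((\<lambda>\<tau>. v \<tau> / \<tau>) \<longlongrightarrow> l) at_top)"

end

theory Submission
  imports Defs
begin

text \<open>
  With the slow variables frozen, translating one solution by integers traps any other solution
  next to it, so all solutions stay within bounded distance of a line whose slope is the rotation
  number \<open>effective_slope f u t\<close>. On a window of length of order \<open>\<epsilon> |log \<epsilon>|\<close> the oscillating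
  solution \<open>u\<^sup>\<epsilon>\<close> is therefore affine up to \<open>O(\<epsilon>)\<close>, with slope frozen at any point
  \<open>(u\<^sup>\<epsilon>(\<sigma>), \<sigma>)\<close> of the window. The mean value theorem gives a \<open>\<sigma>\<close> at which the increment of the
  homogenized solution is the window length times its slope. While \<open>u\<^sup>\<epsilon>\<close> lies above the homogenized
  solution, monotonicity of the effective slope orders the two slopes at \<open>\<sigma>\<close>, so the difference
  grows by at most \<open>O(\<epsilon>)\<close> per window; no modulus of continuity of the effective slope is needed.
  Counting windows from the last crossing gives \<open>O(T / |log \<epsilon>| + \<epsilon>)\<close>, and the lower bound on \<open>T\<close>
  absorbs the last term.
\<close>

section \<open>Scalar Cauchy problems on the half-line\<close>

text \<open>The zeros of \<open>w\<close> in \<open>{a..b}\<close> form a compact set, nonempty by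
  the intermediate value theorem, so there is a largest one; a nonpositive value beyond it would
  produce a later zero.\<close>

lemma last_crossing:
  fixes w :: "real \<Rightarrow> real"
  assumes "a \<le> b" and cont: "continuous_on {a..b} w" and "w a \<le> 0" and "w b > 0"
  obtains s where "a \<le> s" "s < b" "w s = 0" "\<And>r. s < r \<Longrightarrow> r \<le> b \<Longrightarrow> w r > 0"
proof -
  define S where "S = {a..b} \<inter> w -` {0}"
  have "closed S"
    unfolding S_def by (intro continuous_closed_preimage cont) auto
  moreover have "\<exists>s\<ge>a. s \<le> b \<and> w s = 0"
    using assms by (intro IVT') auto
  then have "S \<noteq> {}" by (auto simp: S_def)
  moreover have "bdd_above S" by (auto simp: S_def)
  ultimately have Sup: "Sup S \<in> S"
    by (intro closed_contains_Sup)
  show ?thesis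
  proof
    show "a \<le> Sup S" and 0: "w (Sup S) = 0" using Sup by (auto simp: S_def)
    show "Sup S < b" using Sup 0 \<open>w b > 0\<close> by (cases "Sup S = b") (auto simp: S_def)
    fix r assume r: "Sup S < r" "r \<le> b"
    show "w r > 0"
    proof (rule ccontr)
      assume "\<not> w r > 0"
      then have "\<exists>s\<ge>r. s \<le> b \<and> w s = 0"
        using assms r \<open>a \<le> Sup S\<close> by (intro IVT' continuous_on_subset[OF cont]) auto
      then obtain s where "r \<le> s" "s \<in> S"
        using r \<open>a \<le> Sup S\<close> by (auto simp: S_def)
      then show False
        using cSup_upper[OF \<open>s \<in> S\<close> \<open>bdd_above S\<close>] r by simp
    qed
  qed
qed

text \<open>The derivative is controlled only where \<open>w\<close> is positive, so the argument
  starts at the last zero. With \<open>D = 0\<close> this one-sided form yields the comparison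
  principle.\<close>

lemma gronwall_le:
  fixes w w' :: "real \<Rightarrow> real"
  assumes "a \<le> b" and cont: "continuous_on {a..b} w"
    and deriv: "\<And>s. a < s \<Longrightarrow> s < b \<Longrightarrow> (w has_real_derivative w' s) (at s)"
    and bound: "\<And>s. a < s \<Longrightarrow> s < b \<Longrightarrow> w s > 0 \<Longrightarrow> w' s \<le> L * w s + D"
    and "w a \<le> 0" "0 \<le> L" "0 \<le> D"
  shows "w b \<le> D * (b - a) * exp (L * (b - a))"
proof (cases "w b > 0")
  case False
  have "0 \<le> D * (b - a) * exp (L * (b - a))"
    using assms by simp
  with False show ?thesis by linarith
next
  case True
  then obtain s where s: "a \<le> s" "s < b" "w s = 0" and pos: "\<And>r. s < r \<Longrightarrow> r \<le> b \<Longrightarrow> w r > 0"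
    using last_crossing assms by metis
  \<comment> \<open>The integrating factor removes the growth at rate \<open>L\<close>, and the
    linear term pays for \<open>D\<close>. Hence \<open>p\<close> vanishes at \<open>s\<close> and
    cannot increase afterwards.\<close>
  define p where "p r = w r * exp (- (L * (r - s))) - D * (r - s)" for r
  have "p b \<le> p s"
  proof (rule DERIV_nonpos_imp_decreasing_open[where f = p])
    show "s \<le> b" using s by simp
    show "continuous_on {s..b} p"
      unfolding p_def using s by (intro continuous_intros continuous_on_subset[OF cont]) auto
    fix r assume r: "s < r" "r < b"
    have "(p has_real_derivative (w' r - L * w r) * exp (- (L * (r - s))) - D) (at r)"
      unfolding p_def using r s
      by (auto intro!: derivative_eq_intros deriv simp: algebra_simps)
    moreover have "(w' r - L * w r) * exp (- (L * (r - s))) \<le> D"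
    proof -
      have "(w' r - L * w r) * exp (- (L * (r - s))) \<le> D * exp (- (L * (r - s)))"
        using bound[of r] pos[of r] r s by (intro mult_right_mono) auto
      also have "\<dots> \<le> D * 1"
        using assms r by (intro mult_left_mono) auto
      finally show ?thesis by simp
    qed
    ultimately show "\<exists>y. (p has_real_derivative y) (at r) \<and> y \<le> 0"
      by (intro exI[of _ "(w' r - L * w r) * exp (- (L * (r - s))) - D"]) auto
  qed
  then have "w b * exp (- (L * (b - s))) \<le> D * (b - s)"
    using s by (simp add: p_def)
  then have "w b * exp (- (L * (b - s))) * exp (L * (b - s)) \<le> D * (b - s) * exp (L * (b - s))"
    by (intro mult_right_mono) auto
  then have "w b \<le> D * (b - s) * exp (L * (b - s))"
    by (simp add: exp_minus mult.assoc)
  also have "\<dots> \<le> D * (b - a) * exp (L * (b - a))"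
    using assms s by (intro mult_mono mult_left_mono) (auto intro: mult_left_mono)
  finally show ?thesis .
qed

lemma gronwall_abs_le:
  fixes w w' :: "real \<Rightarrow> real"
  assumes "a \<le> b" and cont: "continuous_on {a..b} w"
    and deriv: "\<And>s. a < s \<Longrightarrow> s < b \<Longrightarrow> (w has_real_derivative w' s) (at s)"
    and bound: "\<And>s. a < s \<Longrightarrow> s < b \<Longrightarrow> \<bar>w' s\<bar> \<le> L * \<bar>w s\<bar> + D"
    and "w a = 0" "0 \<le> L" "0 \<le> D"
  shows "\<bar>w b\<bar> \<le> D * (b - a) * exp (L * (b - a))"
proof -
  have "w b \<le> D * (b - a) * exp (L * (b - a))"
    by (rule gronwall_le[where w' = w']) (use assms in \<open>force simp: abs_le_iff\<close>)+
  moreover have "- w b \<le> D * (b - a) * exp (L * (b - a))"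
    by (rule gronwall_le[where w = "\<lambda>s. - w s" and w' = "\<lambda>s. - w' s"])
      (use assms in \<open>force simp: abs_le_iff intro!: continuous_intros derivative_intros\<close>)+
  ultimately show ?thesis by (simp add: abs_le_iff)
qed

text \<open>Unlike \<open>solves_cauchy\<close>, this fixes no initial value and asks only for
  continuity at 0. Nothing is asked of \<open>g\<close>, so the effective slope is admissible
  without a proof that it is continuous.\<close>

definition half_line_solution :: "(real \<Rightarrow> real \<Rightarrow> real) \<Rightarrow> (real \<Rightarrow> real) \<Rightarrow> bool" where
  "half_line_solution g x \<longleftrightarrow>
     continuous_on {0..} x \<and> (\<forall>s>0. (x has_real_derivative g (x s) s) (at s))"

lemma half_line_solution_deriv:
  "half_line_solution g x \<Longrightarrow> s > 0 \<Longrightarrow> (x has_real_derivative g (x s) s) (at s)"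
  by (simp add: half_line_solution_def)

lemma half_line_solution_continuous_on:
  "half_line_solution g x \<Longrightarrow> A \<subseteq> {0..} \<Longrightarrow> continuous_on A x"
  by (auto simp: half_line_solution_def intro: continuous_on_subset)

lemma solves_cauchy_imp_half_line_solution:
  assumes "solves_cauchy g x0 x"
  shows "half_line_solution g x"
proof -
  obtain x' where "\<And>s. s \<ge> 0 \<Longrightarrow> (x has_real_derivative x' s) (at s within {0..})"
    using assms by (auto simp: solves_cauchy_def C1_half_line_def)
  then have "continuous_on {0..} x"
    by (intro DERIV_continuous_on) auto
  then show ?thesis
    using assms by (simp add: half_line_solution_def solves_cauchy_def)
qed

lemma half_line_solution_mvt:
  assumes sol: "half_line_solution g x" and "0 \<le> a" "a < b"
  obtains s where "a < s" "s < b" "x b - x a = (b - a) * g (x s) s"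
proof -
  have "\<exists>l z. a < z \<and> z < b \<and> (x has_real_derivative l) (at z) \<and> x b - x a = (b - a) * l"
    using assms
    by (intro MVT half_line_solution_continuous_on[OF sol])
       (auto simp: real_differentiable_def intro!: exI[of _ "g (x _) _"] half_line_solution_deriv[OF sol])
  then obtain l z where z: "a < z" "z < b" "(x has_real_derivative l) (at z)" "x b - x a = (b - a) * l"
    by auto
  moreover have "l = g (x z) z"
    using z assms by (intro DERIV_unique[OF _ half_line_solution_deriv[OF sol]]) auto
  ultimately show ?thesis using that by blast
qed

lemma half_line_solution_increment:
  assumes sol: "half_line_solution g x" and "0 \<le> a" "a \<le> b" and bound: "\<And>y s. \<bar>g y s\<bar> \<le> B"
  shows "\<bar>x b - x a\<bar> \<le> B * (b - a)"
proof (cases "a = b")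
  case False
  then obtain s where "x b - x a = (b - a) * g (x s) s"
    using half_line_solution_mvt[OF sol, of a b] assms by force
  moreover have "\<bar>b - a\<bar> * \<bar>g (x s) s\<bar> \<le> (b - a) * B"
    using assms by (intro mult_mono bound) auto
  ultimately show ?thesis by (simp add: abs_mult mult.commute)
qed simp

text \<open>Where \<open>x\<close> exceeds \<open>y\<close>, the order of the fields followed by the
  Lipschitz bound on \<open>h\<close> gives the hypothesis of \<open>gronwall_le\<close> with
  \<open>D = 0\<close>.\<close>

lemma half_line_solution_le:
  assumes x: "half_line_solution g x" and y: "half_line_solution h y" and "x 0 \<le> y 0"
    and le: "\<And>z s. g z s \<le> h z s" and lip: "\<And>y z s. \<bar>h y s - h z s\<bar> \<le> L * \<bar>y - z\<bar>"
    and "0 \<le> L" and "0 \<le> t"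
  shows "x t \<le> y t"
proof -
  have "x t - y t \<le> 0 * (t - 0) * exp (L * (t - 0))"
  proof (rule gronwall_le)
    show "continuous_on {0..t} (\<lambda>t. x t - y t)"
      by (intro continuous_intros half_line_solution_continuous_on[OF x]
          half_line_solution_continuous_on[OF y]) auto
    fix s :: real assume s: "0 < s"
    show "((\<lambda>t. x t - y t) has_real_derivative g (x s) s - h (y s) s) (at s)"
      using s by (intro DERIV_diff half_line_solution_deriv[OF x] half_line_solution_deriv[OF y])
    show "g (x s) s - h (y s) s \<le> L * (x s - y s) + 0" if "x s - y s > 0"
      using le[of "x s" s] lip[of "x s" s "y s"] that by simp
  qed (use assms in auto)
  then show ?thesis by simp
qed

lemma half_line_solution_shift:
  assumes x: "half_line_solution g x" and "0 \<le> c"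
  shows "half_line_solution (\<lambda>y s. g y (c + s)) (\<lambda>s. x (c + s))"
  unfolding half_line_solution_def
proof (intro conjI allI impI)
  show "continuous_on {0..} (\<lambda>s. x (c + s))"
    by (rule continuous_on_compose2[OF half_line_solution_continuous_on[OF x order_refl]])
      (use \<open>0 \<le> c\<close> in \<open>auto intro!: continuous_intros\<close>)
  fix s :: real assume "s > 0"
  then have "(x has_real_derivative g (x (c + s)) (c + s)) (at (s + c))"
    using half_line_solution_deriv[OF x, of "c + s"] \<open>0 \<le> c\<close> by (simp add: add_ac)
  then show "((\<lambda>s. x (c + s)) has_real_derivative g (x (c + s)) (c + s)) (at s)"
    unfolding DERIV_shift by (simp add: add_ac)
qed

text \<open>
  The weight \<open>exp (- K * t)\<close> makes the Picard operator a contraction on the whole half-line at once.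
\<close>

lemma ex_solves_cauchy:
  fixes g :: "real \<Rightarrow> real \<Rightarrow> real"
  assumes cont: "continuous_on UNIV (\<lambda>(y, s). g y s)"
    and bound: "\<And>y s. \<bar>g y s\<bar> \<le> B"
    and lip: "\<And>y z s. \<bar>g y s - g z s\<bar> \<le> L * \<bar>y - z\<bar>" and L: "0 \<le> L"
  shows "\<exists>x. solves_cauchy g x0 x"
proof -
  \<comment> \<open>The term \<open>2 * L\<close> makes the contraction constant at most 1/2; the
    extra 1 keeps \<open>K\<close> positive when \<open>L = 0\<close> and lets
    \<open>exp (K * r)\<close> dominate \<open>r\<close>.\<close>
  define K where "K = 2 * L + 1"
  have K: "K \<ge> 1" "L / K \<le> 1/2" "K > 0" using L by (auto simp: K_def field_simps)
  have cont': "continuous_on A (\<lambda>s. g (y s) s)" if "continuous_on A y" for A :: "real set" and y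
    using continuous_on_compose2[OF cont, of A "\<lambda>s. (y s, s)"] that
    by (simp add: continuous_on_Pair)
  \<comment> \<open>The unknown \<open>z\<close> is the displacement divided by the weight, so a
    bounded \<open>z\<close> can encode an unbounded trajectory.\<close>
  define h where "h z s = g (x0 + exp (K * s) * apply_bcontfun z s) s" for z s
  have cont_h: "continuous_on A (h z)" for A z
    unfolding h_def by (intro cont' continuous_intros) auto
  have int_h: "h z integrable_on {a..b}" for z a b
    by (intro integrable_continuous_real cont_h)
  \<comment> \<open>Bounded continuous functions live on the whole line here; \<open>max 0 t\<close>
    extends the operator by 0 to negative times.\<close>
  define P where "P z t = exp (- (K * max 0 t)) * integral {0..max 0 t} (h z)" for z t
  have deriv_int: "((\<lambda>t. integral {0..t} (h z)) has_real_derivative h z t) (at t within {0..})"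
    if "t \<ge> 0" for z t
  proof -
    have "((\<lambda>t. integral {0..t} (h z)) has_real_derivative h z t) (at t within {0..t+1})"
      using that by (intro integral_has_real_derivative cont_h) auto
    moreover have "at t within {0..t+1} = at t within {0..}"
      using that by (intro at_within_nhd[of _ "{..<t+1}"]) auto
    ultimately show ?thesis by simp
  qed
  have "P z \<in> bcontfun" for z
  proof (rule bcontfun_normI)
    have "continuous_on {0..} (\<lambda>t. integral {0..t} (h z))"
      using deriv_int by (intro DERIV_continuous_on) auto
    then have "continuous_on UNIV (\<lambda>t. integral {0..max 0 t} (h z))"
      by (rule continuous_on_compose2) (auto intro!: continuous_intros)
    then show "continuous_on UNIV (P z)"
      unfolding P_def by (intro continuous_intros)
    fix t :: real
    define r where "r = max 0 t"
    have r: "r \<ge> 0" by (simp add: r_def)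
    have "norm (integral {0..r} (h z)) \<le> B * (r - 0)"
      using r by (intro integral_bound cont_h) (auto simp: h_def bound)
    also have "\<dots> \<le> B * exp (K * r)"
    proof (intro mult_left_mono)
      show "0 \<le> B" using bound[of 0 0] by linarith
      have "1 * r \<le> K * r" using r K by (intro mult_right_mono) auto
      then show "r - 0 \<le> exp (K * r)" using exp_ge_add_one_self[of "K * r"] by linarith
    qed
    finally show "norm (P z t) \<le> B"
      unfolding P_def r_def[symmetric] by (simp add: abs_mult exp_minus field_simps)
  qed
  then have apply_P: "apply_bcontfun (Bcontfun (P z)) = P z" for z
    by (intro Bcontfun_inverse)
  have contraction: "dist (Bcontfun (P y)) (Bcontfun (P z)) \<le> 1/2 * dist y z" for y z
  proof (rule dist_bound)
    fix t :: real
    define r where "r = max 0 t"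
    have r: "r \<ge> 0" by (simp add: r_def)
    \<comment> \<open>Integrating the weight gains the factor \<open>1 / K\<close>, which is the
      source of the contraction.\<close>
    have exp_int: "((\<lambda>s. L * dist y z * exp (K * s)) has_integral
        L * dist y z * exp (K * r) / K - L * dist y z * exp (K * 0) / K) {0..r}"
      using r K by (intro fundamental_theorem_of_calculus)
        (auto intro!: derivative_eq_intros simp: has_real_derivative_iff_has_vector_derivative[symmetric])
    have "norm (integral {0..r} (h y) - integral {0..r} (h z)) = norm (integral {0..r} (\<lambda>s. h y s - h z s))"
      by (simp add: integral_diff int_h)
    also have "\<dots> \<le> integral {0..r} (\<lambda>s. L * dist y z * exp (K * s))"
    proof (rule integral_norm_bound_integral)
      show "(\<lambda>s. h y s - h z s) integrable_on {0..r}"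
        by (intro integrable_diff int_h)
      show "(\<lambda>s. L * dist y z * exp (K * s)) integrable_on {0..r}"
        using exp_int by blast
      fix s
      have "norm (h y s - h z s) \<le> L * \<bar>exp (K * s) * (apply_bcontfun y s - apply_bcontfun z s)\<bar>"
        using lip[of "x0 + exp (K * s) * apply_bcontfun y s" s "x0 + exp (K * s) * apply_bcontfun z s"]
        by (simp add: h_def algebra_simps)
      also have "\<dots> \<le> L * (exp (K * s) * dist y z)"
        using dist_bounded[of y s z] L by (intro mult_left_mono) (auto simp: abs_mult dist_real_def)
      finally show "norm (h y s - h z s) \<le> L * dist y z * exp (K * s)"
        by (simp add: mult_ac)
    qed
    also have "\<dots> = L * dist y z * exp (K * r) / K - L * dist y z * exp (K * 0) / K"
      using exp_int by (rule integral_unique)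
    also have "\<dots> \<le> (L / K) * (dist y z * exp (K * r))"
    proof -
      have "0 \<le> L * dist y z / K" using L K by simp
      then show ?thesis by (simp add: mult.assoc)
    qed
    also have "\<dots> \<le> (1 / 2) * (dist y z * exp (K * r))"
      using K by (intro mult_right_mono) auto
    finally have *: "norm (integral {0..r} (h y) - integral {0..r} (h z)) \<le> (1 / 2) * (dist y z * exp (K * r))" .
    have "dist (P y t) (P z t) = exp (- (K * r)) * norm (integral {0..r} (h y) - integral {0..r} (h z))"
      unfolding P_def r_def[symmetric] by (simp add: dist_real_def abs_mult flip: right_diff_distrib)
    also have "\<dots> \<le> exp (- (K * r)) * ((1 / 2) * (dist y z * exp (K * r)))"
      using * by (intro mult_left_mono) auto
    also have "\<dots> = 1 / 2 * dist y z"
      by (simp add: exp_minus)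
    finally show "dist (apply_bcontfun (Bcontfun (P y)) t) (apply_bcontfun (Bcontfun (P z)) t) \<le> 1 / 2 * dist y z"
      by (simp add: apply_P)
  qed
  have "\<exists>!z. Bcontfun (P z) = z"
    by (rule banach_fix_type[of "1/2"]) (use contraction in auto)
  then obtain z where z: "Bcontfun (P z) = z" by blast
  define x where "x t = x0 + integral {0..t} (h z)" for t
  have h_eq: "h z t = g (x t) t" if "t \<ge> 0" for t
  proof -
    have "apply_bcontfun z t = exp (- (K * t)) * integral {0..t} (h z)"
      using apply_P[of z] that by (simp add: z P_def)
    then show ?thesis by (simp add: h_def x_def exp_minus flip: mult.assoc)
  qed
  have deriv: "(x has_real_derivative g (x t) t) (at t within {0..})" if "t \<ge> 0" for t
    unfolding h_eq[OF that, symmetric] using that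
    unfolding x_def by (auto intro!: derivative_eq_intros deriv_int)
  have "solves_cauchy g x0 x"
    unfolding solves_cauchy_def C1_half_line_def
  proof (intro conjI exI allI impI)
    show "(x has_real_derivative g (x s) s) (at s within {0..})" if "0 \<le> s" for s
      using deriv that .
    show "continuous_on {0..} (\<lambda>s. g (x s) s)"
      using deriv by (intro cont' DERIV_continuous_on) auto
    show "(x has_real_derivative g (x s) s) (at s)" if "0 < s" for s
      using deriv[of s] that at_within_interior[of s "{0..}"] by simp
    show "x 0 = x0" by (simp add: x_def)
  qed
  then show ?thesis by blast
qed

section \<open>Rotation numbers of periodic fields\<close>

locale periodic_field =
  fixes g :: "real \<Rightarrow> real \<Rightarrow> real" and L B :: real
  assumes continuous: "continuous_on UNIV (\<lambda>(y, s). g y s)"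
    and lipschitz: "\<And>y z s. \<bar>g y s - g z s\<bar> \<le> L * \<bar>y - z\<bar>"
    and L_nonneg: "0 \<le> L"
    and bound: "\<And>y s. \<bar>g y s\<bar> \<le> B"
    and periodic: "\<And>y s l k. g (y + of_int l) (s + of_int k) = g y s"
begin

lemma B_nonneg: "0 \<le> B"
  using bound[of 0 0] by linarith

lemma ex_solution: "\<exists>v. solves_cauchy g v0 v"
  using ex_solves_cauchy[OF continuous bound lipschitz L_nonneg] .

lemma half_line_solution_shift_int:
  fixes l :: int
  assumes v: "half_line_solution g v"
  shows "half_line_solution g (\<lambda>s. v (real n + s) + of_int l)"
proof -
  have "g y (real n + s) = g (y + of_int l) s" for y s
    using periodic[of "y" l s 0] periodic[of y 0 s "int n"] by (simp add: add_ac)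
  then have "half_line_solution (\<lambda>y s. g (y + of_int l) s) (\<lambda>s. v (real n + s))"
    using half_line_solution_shift[OF v, of "real n"] by simp
  then show ?thesis
    by (auto simp: half_line_solution_def intro!: continuous_intros derivative_eq_intros)
qed

text \<open>Two consecutive integer translates of \<open>w\<close> bracket \<open>v\<close> at time
  0. By periodicity both are solutions, so comparison keeps \<open>v - w\<close> between
  \<open>l\<close> and \<open>l + 1\<close> for ever.\<close>

lemma solutions_travel_together:
  assumes v: "half_line_solution g v" and w: "half_line_solution g w" and "0 \<le> s"
  shows "\<bar>(v s - v 0) - (w s - w 0)\<bar> \<le> 1"
proof -
  define l where "l = \<lfloor>v 0 - w 0\<rfloor>"
  have l: "of_int l \<le> v 0 - w 0" "v 0 - w 0 \<le> of_int l + 1"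
    unfolding l_def by linarith+
  have shifted: "half_line_solution g (\<lambda>s. w s + of_int k)" for k
    using half_line_solution_shift_int[OF w, of 0] by simp
  have "w s + of_int l \<le> v s"
    by (rule half_line_solution_le[OF shifted v _ order_refl lipschitz L_nonneg \<open>0 \<le> s\<close>])
      (use l in simp)
  moreover have "v s \<le> w s + of_int (l + 1)"
    by (rule half_line_solution_le[OF v shifted _ order_refl lipschitz L_nonneg \<open>0 \<le> s\<close>])
      (use l in simp)
  ultimately show ?thesis using l by (simp add: abs_le_iff)
qed

text \<open>A Fekete argument with explicit error: \<open>a n + 1\<close> is subadditive and
  \<open>a n - 1\<close> superadditive, so all lower quotients lie below all upper ones and the
  number between them is within \<open>1 / n\<close> of \<open>a n / n\<close>. In the final bound,
  one unit comes from this, one from replacing \<open>v\<close> by \<open>w\<close>, and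
  \<open>2 * B\<close> from rounding \<open>s\<close> down to an integer.\<close>

lemma ex_rotation_number:
  "\<exists>\<rho>. \<bar>\<rho>\<bar> \<le> B \<and> (\<forall>v s. half_line_solution g v \<longrightarrow> 0 \<le> s \<longrightarrow> \<bar>v s - v 0 - \<rho> * s\<bar> \<le> 2 + 2 * B)"
proof -
  obtain w where w: "half_line_solution g w"
    using ex_solution solves_cauchy_imp_half_line_solution by blast
  define a where "a n = w (real n) - w 0" for n
  \<comment> \<open>The trajectory seen from time \<open>m\<close> on solves the same equation, so
    its increment over \<open>n\<close> periods differs from that of \<open>w\<close> by at most
    1.\<close>
  have quasi_additive: "\<bar>a (m + n) - a m - a n\<bar> \<le> 1" for m n
    using solutions_travel_together[OF half_line_solution_shift_int[OF w, of m 0] w, of "real n"]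
    by (simp add: a_def algebra_simps)
  have mult_le: "a (m * n) + 1 \<le> real n * (a m + 1)" if "n \<ge> 1" for m n
    using that
  proof (induction n rule: dec_induct)
    case (step n)
    then show ?case
      using quasi_additive[of m "m * n"] by (simp add: algebra_simps abs_le_iff)
  qed simp
  have le_mult: "real n * (a m - 1) \<le> a (m * n) - 1" if "n \<ge> 1" for m n
    using that
  proof (induction n rule: dec_induct)
    case (step n)
    then show ?case
      using quasi_additive[of m "m * n"] by (simp add: algebra_simps abs_le_iff)
  qed simp
  define \<rho> where "\<rho> = (INF n\<in>{1..}. (a n + 1) / real n)"
  have sub_super: "(a m - 1) / real m \<le> (a n + 1) / real n" if "m \<ge> 1" "n \<ge> 1" for m n
  proof -
    have "real n * (a m - 1) \<le> real m * (a n + 1)"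
      using le_mult[OF that(2), of m] mult_le[OF that(1), of n] by (simp add: mult.commute)
    then show ?thesis
      using that by (simp add: field_simps)
  qed
  have near: "\<bar>a n - \<rho> * real n\<bar> \<le> 1" for n
  proof (cases "n = 0")
    case False
    then have n: "n \<ge> 1" by simp
    have "\<rho> \<le> (a n + 1) / real n"
      unfolding \<rho>_def using n sub_super[of 1]
      by (intro cINF_lower bdd_belowI2[of _ "(a 1 - 1) / real 1"]) auto
    moreover have "(a n - 1) / real n \<le> \<rho>"
      unfolding \<rho>_def using n sub_super by (intro cINF_greatest) auto
    ultimately show ?thesis
      using n by (simp add: abs_le_iff field_simps)
  qed (simp add: a_def)
  \<comment> \<open>\<open>\<rho> * n\<close> is within 1 of an increment of size at most
    \<open>B * n\<close>; the 1 disappears after division by a large \<open>n\<close>.\<close>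
  have \<rho>_le: "\<bar>\<rho>\<bar> \<le> B"
  proof (rule field_le_epsilon)
    fix e :: real assume "e > 0"
    then obtain n where n: "real n * e > 1"
      using reals_Archimedean3 by blast
    then have "n > 0" by (cases n) auto
    have "\<bar>a n\<bar> \<le> B * real n"
      using half_line_solution_increment[OF w order_refl, of "real n" B] bound by (simp add: a_def)
    then have "\<bar>\<rho> * real n\<bar> \<le> B * real n + 1"
      using near[of n] by linarith
    then have "\<bar>\<rho>\<bar> * real n \<le> (B + e) * real n"
      using n by (simp add: abs_mult algebra_simps)
    then show "\<bar>\<rho>\<bar> \<le> B + e"
      using \<open>n > 0\<close> by simp
  qed
  have "\<bar>v s - v 0 - \<rho> * s\<bar> \<le> 2 + 2 * B" if v: "half_line_solution g v" and s: "0 \<le> s" for v s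
  proof -
    define n where "n = nat \<lfloor>s\<rfloor>"
    have n: "real n \<le> s" "s - real n \<le> 1"
      using s unfolding n_def by linarith+
    have "\<bar>w s - w (real n)\<bar> \<le> B * (s - real n)"
      using n bound by (intro half_line_solution_increment[OF w]) auto
    moreover have "B * (s - real n) \<le> B * 1"
      using n B_nonneg by (intro mult_left_mono) auto
    moreover have "\<bar>\<rho> * s - \<rho> * real n\<bar> \<le> B * 1"
      using n \<rho>_le B_nonneg
      unfolding right_diff_distrib[symmetric] abs_mult by (intro mult_mono) auto
    moreover note near[of n] solutions_travel_together[OF v w s]
    ultimately show ?thesis by (simp add: a_def abs_le_iff)
  qed
  with \<rho>_le show ?thesis by blast
qed

text \<open>The number is selected by the uniform deviation bound, which the window estimate needs;
  the limit of \<open>v s / s\<close> is then a consequence.\<close>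

definition rotation_number :: real where
  "rotation_number = (SOME \<rho>. \<bar>\<rho>\<bar> \<le> B \<and>
     (\<forall>v s. half_line_solution g v \<longrightarrow> 0 \<le> s \<longrightarrow> \<bar>v s - v 0 - \<rho> * s\<bar> \<le> 2 + 2 * B))"

lemma abs_rotation_number_le: "\<bar>rotation_number\<bar> \<le> B"
  using someI_ex[OF ex_rotation_number] unfolding rotation_number_def by blast

lemma rotation_deviation:
  "half_line_solution g v \<Longrightarrow> 0 \<le> s \<Longrightarrow> \<bar>v s - v 0 - rotation_number * s\<bar> \<le> 2 + 2 * B"
  using someI_ex[OF ex_rotation_number] unfolding rotation_number_def by blast

text \<open>Windows start at arbitrary fast times \<open>c\<close>. Waiting at most one unit reaches
  an integer time, where the field is \<open>g\<close> again; the wait costs \<open>B\<close> for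
  the solution and \<open>B\<close> for the linear term.\<close>

lemma rotation_deviation_delayed:
  assumes y: "half_line_solution (\<lambda>z s. g z (c + s)) y" and "0 \<le> c" "0 \<le> s"
  shows "\<bar>y s - y 0 - rotation_number * s\<bar> \<le> 2 + 4 * B"
proof -
  define n where "n = nat \<lceil>c\<rceil>"
  define d where "d = real n - c"
  have d: "0 \<le> d" "d \<le> 1"
    using \<open>0 \<le> c\<close> unfolding d_def n_def by linarith+
  \<comment> \<open>The minimum covers the case in which time \<open>s\<close> is over before the
    next integer is reached.\<close>
  define r where "r = min s d"
  have r: "0 \<le> r" "r \<le> 1" "r \<le> s"
    using d \<open>0 \<le> s\<close> by (auto simp: r_def)
  have "\<bar>y r - y 0\<bar> \<le> B * (r - 0)"
    using r bound by (intro half_line_solution_increment[OF y]) auto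
  also have "\<dots> \<le> B * 1"
    using r B_nonneg by (intro mult_left_mono) auto
  finally have 1: "\<bar>y r - y 0\<bar> \<le> B" by simp
  have "\<bar>rotation_number * r\<bar> \<le> B * 1"
    using r abs_rotation_number_le B_nonneg unfolding abs_mult by (intro mult_mono) auto
  then have 2: "\<bar>rotation_number * r\<bar> \<le> B" by simp
  have 3: "\<bar>y s - y r - rotation_number * (s - r)\<bar> \<le> 2 + 2 * B"
  proof (cases "s \<le> d")
    case True
    then show ?thesis using B_nonneg by (simp add: r_def)
  next
    case False
    have "g z (c + (d + s)) = g z s" for z s
      using periodic[of z 0 s "int n"] by (simp add: d_def add_ac)
    then have "half_line_solution g (\<lambda>s. y (d + s))"
      using half_line_solution_shift[OF y \<open>0 \<le> d\<close>] by simp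
    from rotation_deviation[OF this, of "s - d"] show ?thesis
      using False by (simp add: r_def)
  qed
  have "rotation_number * s = rotation_number * (s - r) + rotation_number * r"
    by (simp add: algebra_simps)
  with 1 2 3 show ?thesis by linarith
qed

lemma tendsto_rotation_number:
  assumes v: "half_line_solution g v"
  shows "((\<lambda>s. v s / s) \<longlongrightarrow> rotation_number) at_top"
proof (rule LIM_zero_cancel, rule Lim_null_comparison)
  show "((\<lambda>s. (2 + 2 * B + \<bar>v 0\<bar>) / s) \<longlongrightarrow> 0) at_top"
    by (intro tendsto_divide_0[OF tendsto_const] filterlim_at_top_imp_at_infinity filterlim_ident)
  show "\<forall>\<^sub>F s in at_top. norm (v s / s - rotation_number) \<le> (2 + 2 * B + \<bar>v 0\<bar>) / s"
    using eventually_gt_at_top[of 0]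
  proof eventually_elim
    case (elim s)
    have "v s / s - rotation_number = (v s - rotation_number * s) / s"
      using elim by (simp add: field_simps)
    moreover have "\<bar>v s - rotation_number * s\<bar> \<le> 2 + 2 * B + \<bar>v 0\<bar>"
      using rotation_deviation[OF v, of s] elim by linarith
    ultimately show ?case
      using elim by (simp add: abs_divide divide_right_mono)
  qed
qed

end

text \<open>Uniqueness in the definite description rests on existence of a solution: without one,
  every \<open>l\<close> would satisfy the condition vacuously.\<close>

lemma effective_slope_eq_rotation_number:
  assumes "periodic_field (\<lambda>y \<tau>. f (y, \<tau>, u, t)) L B"
  shows "effective_slope f u t = periodic_field.rotation_number (\<lambda>y \<tau>. f (y, \<tau>, u, t)) B"
proof -
  interpret periodic_field "\<lambda>y \<tau>. f (y, \<tau>, u, t)" L B by fact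
  show ?thesis
    unfolding effective_slope_def
  proof (rule the_equality)
    show "\<forall>v0 v. solves_cauchy (\<lambda>y \<tau>. f (y, \<tau>, u, t)) v0 v \<longrightarrow>
        ((\<lambda>\<tau>. v \<tau> / \<tau>) \<longlongrightarrow> rotation_number) at_top"
      using tendsto_rotation_number solves_cauchy_imp_half_line_solution by blast
  next
    fix l
    assume l: "\<forall>v0 v. solves_cauchy (\<lambda>y \<tau>. f (y, \<tau>, u, t)) v0 v \<longrightarrow>
        ((\<lambda>\<tau>. v \<tau> / \<tau>) \<longlongrightarrow> l) at_top"
    obtain v where v: "solves_cauchy (\<lambda>y \<tau>. f (y, \<tau>, u, t)) 0 v"
      using ex_solution by blast
    show "l = rotation_number"
      using l v tendsto_rotation_number[OF solves_cauchy_imp_half_line_solution[OF v]]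
      by (intro tendsto_unique[OF trivial_limit_at_top_linorder, where f = "\<lambda>s. v s / s"]) blast+
  qed
qed

section \<open>Freezing the slow variables\<close>

lemma increment_le_by_windows:
  fixes d :: "real \<Rightarrow> real"
  assumes "s \<le> t" "0 < h" "0 \<le> e"
    and window: "\<And>a b. s \<le> a \<Longrightarrow> a \<le> b \<Longrightarrow> b \<le> t \<Longrightarrow> b - a \<le> h \<Longrightarrow> d b - d a \<le> e"
  shows "d t - d s \<le> e * ((t - s) / h + 1)"
proof -
  have *: "d r - d s \<le> real n * e" if "s \<le> r" "r \<le> t" "r - s \<le> real n * h" for n r
    using that
  proof (induction n arbitrary: r)
    case (Suc n)
    \<comment> \<open>The last window is removed from the right end and clipped at \<open>s\<close>,
      so only this first piece from \<open>s\<close> may be shorter than \<open>h\<close>.\<close>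
    define q where "q = max s (r - h)"
    have "d q - d s \<le> real n * e"
      using Suc.prems \<open>0 < h\<close> by (intro Suc.IH) (auto simp: q_def algebra_simps)
    moreover have "d r - d q \<le> e"
      using Suc.prems \<open>0 < h\<close> by (intro window) (auto simp: q_def)
    ultimately show ?case by (simp add: algebra_simps)
  qed auto
  define n where "n = nat \<lceil>(t - s) / h\<rceil>"
  have "0 \<le> (t - s) / h" using assms by simp
  then have n: "(t - s) / h \<le> real n" "real n \<le> (t - s) / h + 1"
    unfolding n_def by linarith+
  have "d t - d s \<le> real n * e"
    using n assms by (intro *) (auto simp: field_simps)
  also have "\<dots> \<le> ((t - s) / h + 1) * e"
    using n assms by (intro mult_right_mono) auto
  finally show ?thesis by (simp add: mult.commute)
qed

text \<open>After its last zero \<open>d\<close> stays positive, so every later window obeys the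
  hypothesis. The summand 1 counts the incomplete window.\<close>

lemma excursion_bound:
  fixes d :: "real \<Rightarrow> real"
  assumes cont: "continuous_on {0..t} d" and "d 0 = 0" "0 \<le> t" "0 < h" "0 \<le> e"
    and window: "\<And>a b. 0 \<le> a \<Longrightarrow> a < b \<Longrightarrow> b - a \<le> h \<Longrightarrow> (\<And>r. a < r \<Longrightarrow> r < b \<Longrightarrow> d r > 0) \<Longrightarrow> d b - d a \<le> e"
  shows "d t \<le> e * (t / h + 1)"
proof (cases "d t > 0")
  case False
  have "0 \<le> e * (t / h + 1)" using assms by simp
  with False show ?thesis by linarith
next
  case True
  obtain s where s: "0 \<le> s" "s < t" "d s = 0" and pos: "\<And>r. s < r \<Longrightarrow> r \<le> t \<Longrightarrow> d r > 0"
    using last_crossing[OF \<open>0 \<le> t\<close> cont _ True] \<open>d 0 = 0\<close> by auto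
  have "d t - d s \<le> e * ((t - s) / h + 1)"
  proof (rule increment_le_by_windows)
    fix a b assume ab: "s \<le> a" "a \<le> b" "b \<le> t" "b - a \<le> h"
    show "d b - d a \<le> e"
    proof (cases "a = b")
      case False
      then show ?thesis using ab s pos by (intro window) auto
    qed (use \<open>0 \<le> e\<close> in simp)
  qed (use s assms in auto)
  also have "\<dots> \<le> e * (t / h + 1)"
    using s assms by (intro mult_left_mono add_right_mono divide_right_mono) auto
  finally show ?thesis using s by simp
qed

text \<open>The Lipschitz bound is stated for the sum of coordinate distances so that each slow
  variable can be frozen separately. \<open>A\<close> is at least 1 so that the window length is
  finite and \<open>A \<le> A\<^sup>2\<close>.\<close>

locale oscillating_field =
  fixes f :: "real \<times> real \<times> real \<times> real \<Rightarrow> real" and A B :: real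
  assumes lipschitz: "\<And>v \<tau> u t v' \<tau>' u' t'. \<bar>f (v, \<tau>, u, t) - f (v', \<tau>', u', t')\<bar>
      \<le> A * (\<bar>v - v'\<bar> + \<bar>\<tau> - \<tau>'\<bar> + \<bar>u - u'\<bar> + \<bar>t - t'\<bar>)"
    and continuous: "continuous_on UNIV f"
    and A: "1 \<le> A"
    and bound: "\<And>p. \<bar>f p\<bar> \<le> B"
    and periodic: "\<And>v \<tau> u t l k. f (v + of_int l, \<tau> + of_int k, u, t) = f (v, \<tau>, u, t)"
    and antimono: "\<And>v \<tau> t. antimono (\<lambda>u. f (v, \<tau>, u, t))"
begin

lemma B_nonneg: "0 \<le> B"
  using bound[of 0] by linarith

lemma periodic_field_frozen: "periodic_field (\<lambda>v \<tau>. f (v, \<tau>, u, t)) A B"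
proof
  show "continuous_on UNIV (\<lambda>(v, \<tau>). f (v, \<tau>, u, t))"
    unfolding case_prod_beta
    by (rule continuous_on_compose2[OF continuous]) (auto intro!: continuous_intros)
  show "\<bar>f (y, s, u, t) - f (z, s, u, t)\<bar> \<le> A * \<bar>y - z\<bar>" for y z s
    using lipschitz[of y s u t z s u t] by simp
  show "0 \<le> A" using A by simp
qed (fact bound periodic)+

abbreviation slope :: "real \<Rightarrow> real \<Rightarrow> real" where
  "slope \<equiv> effective_slope f"

lemma slope_deviation:
  assumes "half_line_solution (\<lambda>z s. f (z, c + s, u, t)) y" "0 \<le> c" "0 \<le> s"
  shows "\<bar>y s - y 0 - slope u t * s\<bar> \<le> 2 + 4 * B"
  using periodic_field.rotation_deviation_delayed[OF periodic_field_frozen assms]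
    effective_slope_eq_rotation_number[OF periodic_field_frozen] by simp

lemma slope_antimono:
  assumes "u \<le> u'"
  shows "slope u' t \<le> slope u t"
proof -
  interpret F: periodic_field "\<lambda>v \<tau>. f (v, \<tau>, u, t)" A B by (rule periodic_field_frozen)
  interpret F': periodic_field "\<lambda>v \<tau>. f (v, \<tau>, u', t)" A B by (rule periodic_field_frozen)
  obtain v where v: "solves_cauchy (\<lambda>v \<tau>. f (v, \<tau>, u, t)) 0 v"
    using F.ex_solution by blast
  obtain v' where v': "solves_cauchy (\<lambda>v \<tau>. f (v, \<tau>, u', t)) 0 v'"
    using F'.ex_solution by blast
  note sol = solves_cauchy_imp_half_line_solution[OF v] solves_cauchy_imp_half_line_solution[OF v']
  have le: "f (z, s, u', t) \<le> f (z, s, u, t)" for z s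
    using antimonoD[OF antimono \<open>u \<le> u'\<close>] .
  have "v' s \<le> v s" if "0 \<le> s" for s
    by (rule half_line_solution_le[OF sol(2,1) _ le F.lipschitz F.L_nonneg that])
      (use v v' in \<open>simp add: solves_cauchy_def\<close>)
  then have "\<forall>\<^sub>F s in at_top. v' s / s \<le> v s / s"
    by (intro eventually_at_top_linorderI[of 0] divide_right_mono)
  then have "F'.rotation_number \<le> F.rotation_number"
    by (intro tendsto_le[OF trivial_limit_at_top_linorder
          F.tendsto_rotation_number[OF sol(1)] F'.tendsto_rotation_number[OF sol(2)]])
  then show ?thesis
    by (simp add: effective_slope_eq_rotation_number[OF periodic_field_frozen])
qed

text \<open>
  On a window of length \<open>\<epsilon> * (- ln \<epsilon> / (2 * A))\<close> the error made by freezing the slow variables,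
  of size \<open>O(\<epsilon> |log \<epsilon>|^2)\<close> before amplification, grows by Gronwall's inequality at most by a factor
  \<open>1 / sqrt \<epsilon>\<close>, so it stays of order 1 in the fast scale, like the rotation deviation.
\<close>

lemma window_estimate:
  assumes x: "half_line_solution (\<lambda>u t. f (u / \<epsilon>, t / \<epsilon>, u, t)) x"
    and \<epsilon>: "0 < \<epsilon>" "\<epsilon> < 1"
    and order: "0 \<le> a" "a \<le> \<sigma>" "\<sigma> \<le> b"
    and short: "b - a \<le> \<epsilon> * (- ln \<epsilon> / (2 * A))"
  shows "\<bar>x b - x a - slope (x \<sigma>) \<sigma> * (b - a)\<bar> \<le> (4 + 6 * B) * \<epsilon>"
proof -
  define R where "R = (b - a) / \<epsilon>"
  have R: "0 \<le> R" "a + \<epsilon> * R = b"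
    using \<epsilon> order by (auto simp: R_def)
  define c where "c = a / \<epsilon>"
  have c: "0 \<le> c" using \<epsilon> order by (simp add: c_def)
  \<comment> \<open>This bounds the freezing error of the field: over the window time moves by at
    most \<open>b - a\<close> and \<open>x\<close> by at most \<open>B * (b - a)\<close>.\<close>
  define D where "D = A * ((B + 1) * (b - a))"
  have D: "0 \<le> D" using A B_nonneg order by (simp add: D_def)
  interpret G: periodic_field "\<lambda>v \<tau>. f (v, \<tau>, x \<sigma>, \<sigma>)" A B by (rule periodic_field_frozen)
  have "continuous_on UNIV (\<lambda>(z, s). f (z, c + s, x \<sigma>, \<sigma>))"
    unfolding case_prod_beta
    by (rule continuous_on_compose2[OF continuous]) (auto intro!: continuous_intros)
  \<comment> \<open>The comparison solution runs in fast time from the same rescaled point, with the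
    slow variables held at \<open>\<sigma>\<close>.\<close>
  then obtain y where y: "solves_cauchy (\<lambda>z s. f (z, c + s, x \<sigma>, \<sigma>)) (x a / \<epsilon>) y"
    using ex_solves_cauchy[OF _ G.bound G.lipschitz G.L_nonneg] by force
  note sol = solves_cauchy_imp_half_line_solution[OF y]
  have increment: "\<bar>x q - x p\<bar> \<le> B * (q - p)" if "0 \<le> p" "p \<le> q" for p q
    using half_line_solution_increment[OF x that] bound by simp
  define w where "w s = x (a + \<epsilon> * s) / \<epsilon> - y s" for s
  define w' where "w' s = f (x (a + \<epsilon> * s) / \<epsilon>, c + s, x (a + \<epsilon> * s), a + \<epsilon> * s)
      - f (y s, c + s, x \<sigma>, \<sigma>)" for s
  have "\<bar>w R\<bar> \<le> D * (R - 0) * exp (A * (R - 0))"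
  proof (rule gronwall_abs_le)
    have "continuous_on {0..R} (\<lambda>s. x (a + \<epsilon> * s))"
      by (rule continuous_on_compose2[OF half_line_solution_continuous_on[OF x order_refl]])
        (use \<epsilon> order in \<open>auto intro!: continuous_intros\<close>)
    then show "continuous_on {0..R} w"
      unfolding w_def using \<epsilon>
      by (intro continuous_intros half_line_solution_continuous_on[OF sol]) auto
    show "w 0 = 0"
      using y by (simp add: w_def solves_cauchy_def)
    fix s assume s: "0 < s" "s < R"
    have slow: "a < a + \<epsilon> * s" "a + \<epsilon> * s < b"
      using s \<epsilon> R(2) by (auto simp flip: R(2))
    have "(x has_real_derivative f (x (a + \<epsilon> * s) / \<epsilon>, c + s, x (a + \<epsilon> * s), a + \<epsilon> * s)) (at (a + \<epsilon> * s))"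
      using half_line_solution_deriv[OF x, of "a + \<epsilon> * s"] slow order \<epsilon>
      by (simp add: c_def add_divide_distrib)
    moreover have "((\<lambda>s. a + \<epsilon> * s) has_real_derivative \<epsilon>) (at s)"
      by (auto intro!: derivative_eq_intros)
    ultimately have "((\<lambda>s. x (a + \<epsilon> * s)) has_real_derivative
        f (x (a + \<epsilon> * s) / \<epsilon>, c + s, x (a + \<epsilon> * s), a + \<epsilon> * s) * \<epsilon>) (at s)"
      by (rule DERIV_chain2)
    then show "(w has_real_derivative w' s) (at s)"
      unfolding w_def w'_def using \<epsilon> half_line_solution_deriv[OF sol, of s] s
      by (auto intro!: derivative_eq_intros)
    have "\<bar>w' s\<bar> \<le> A * (\<bar>w s\<bar> + (\<bar>x (a + \<epsilon> * s) - x \<sigma>\<bar> + \<bar>a + \<epsilon> * s - \<sigma>\<bar>))"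
      using lipschitz[of "x (a + \<epsilon> * s) / \<epsilon>" "c + s" "x (a + \<epsilon> * s)" "a + \<epsilon> * s"
          "y s" "c + s" "x \<sigma>" \<sigma>]
      by (simp add: w_def w'_def add.assoc)
    also have "\<dots> \<le> A * (\<bar>w s\<bar> + (B + 1) * (b - a))"
    proof -
      have "\<bar>x (a + \<epsilon> * s) - x \<sigma>\<bar> \<le> B * \<bar>a + \<epsilon> * s - \<sigma>\<bar>"
        using increment[of "a + \<epsilon> * s" \<sigma>] increment[of \<sigma> "a + \<epsilon> * s"] slow order
        by (cases "a + \<epsilon> * s \<le> \<sigma>") (auto simp: abs_minus_commute)
      moreover have "\<bar>a + \<epsilon> * s - \<sigma>\<bar> \<le> b - a"
        using slow order by linarith
      moreover from this have "B * \<bar>a + \<epsilon> * s - \<sigma>\<bar> \<le> B * (b - a)"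
        using B_nonneg by (rule mult_left_mono)
      ultimately show ?thesis
        using A by (intro mult_left_mono) (auto simp: algebra_simps)
    qed
    finally show "\<bar>w' s\<bar> \<le> A * \<bar>w s\<bar> + D"
      by (simp add: D_def algebra_simps)
  qed (use R A D in auto)
  also have "D * (R - 0) * exp (A * (R - 0)) \<le> 2 * B + 2"
  proof -
    define X where "X = A * R"
    \<comment> \<open>Here \<open>\<epsilon> = exp (- l) * exp (- l)\<close>. One factor cancels the
      Gronwall growth \<open>exp X \<le> exp l\<close>, the other absorbs the square through
      \<open>l\<^sup>2 \<le> 2 * exp l\<close>.\<close>
    define l where "l = - ln \<epsilon> / 2"
    have X: "0 \<le> X" "X \<le> l"
      using R A \<epsilon> short by (auto simp: X_def R_def l_def field_simps)
    have "\<epsilon> = exp (- l) * exp (- l)"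
      using \<epsilon> by (simp add: l_def flip: exp_add)
    then have "\<epsilon> * exp X * X\<^sup>2 = exp (- l) * exp (X - l) * X\<^sup>2"
      by (simp add: exp_diff exp_minus field_simps)
    also have "\<dots> \<le> exp (- l) * 1 * l\<^sup>2"
      using X by (intro mult_mono power_mono) auto
    also have "\<dots> \<le> exp (- l) * 1 * (2 * exp l)"
      using exp_lower_Taylor_quadratic[of l] X by (intro mult_left_mono) auto
    also have "\<dots> = 2"
      by (simp add: exp_minus field_simps)
    finally have *: "\<epsilon> * exp X * X\<^sup>2 \<le> 2" .
    have "D * R * exp X = (B + 1) * (\<epsilon> * exp X * (A * R\<^sup>2))"
      using R(2) by (simp add: D_def power2_eq_square flip: R(2))
    also have "\<dots> \<le> (B + 1) * (\<epsilon> * exp X * (A\<^sup>2 * R\<^sup>2))"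
      using A B_nonneg \<epsilon> self_le_power[of A 2] by (intro mult_left_mono mult_right_mono) auto
    also have "\<dots> \<le> (B + 1) * 2"
      using * B_nonneg by (intro mult_left_mono) (auto simp: X_def power_mult_distrib)
    finally show ?thesis by (simp add: X_def)
  qed
  finally have "\<bar>w R\<bar> \<le> 2 * B + 2" .
  moreover have "\<bar>y R - y 0 - slope (x \<sigma>) \<sigma> * R\<bar> \<le> 2 + 4 * B"
    using slope_deviation[OF sol c R(1)] .
  moreover have "y 0 = x a / \<epsilon>"
    using y by (simp add: solves_cauchy_def)
  \<comment> \<open>The constant is the sum of the freezing error \<open>2 * B + 2\<close> and the
    rotation deviation \<open>2 + 4 * B\<close>.\<close>
  ultimately have "\<bar>x b / \<epsilon> - x a / \<epsilon> - slope (x \<sigma>) \<sigma> * R\<bar> \<le> 4 + 6 * B"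
    unfolding w_def R(2) by linarith
  moreover have "x b / \<epsilon> - x a / \<epsilon> - slope (x \<sigma>) \<sigma> * R = (x b - x a - slope (x \<sigma>) \<sigma> * (b - a)) / \<epsilon>"
    by (simp add: R_def diff_divide_distrib right_diff_distrib)
  ultimately show ?thesis
    using \<epsilon> by (simp add: abs_divide field_simps)
qed

text \<open>The freezing point in \<open>window_estimate\<close> is free, so it can be the mean
  value time of \<open>y\<close>. The two signs of \<open>x - y\<close> use the two halves of the
  estimate.\<close>

lemma homogenization_error:
  assumes x: "half_line_solution (\<lambda>u t. f (u / \<epsilon>, t / \<epsilon>, u, t)) x"
    and y: "half_line_solution slope y" and "x 0 = y 0"
    and \<epsilon>: "0 < \<epsilon>" "\<epsilon> < 1" and t: "0 \<le> t"
  shows "\<bar>x t - y t\<bar> \<le> (4 + 6 * B) * \<epsilon> * (t / (\<epsilon> * (- ln \<epsilon> / (2 * A))) + 1)"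
proof -
  define h where "h = \<epsilon> * (- ln \<epsilon> / (2 * A))"
  have h: "0 < h"
    unfolding h_def using \<epsilon> A by (intro mult_pos_pos divide_pos_pos) auto
  have e: "0 \<le> (4 + 6 * B) * \<epsilon>" using B_nonneg \<epsilon> by simp
  note cont = half_line_solution_continuous_on[OF x] half_line_solution_continuous_on[OF y]
  have "x t - y t \<le> (4 + 6 * B) * \<epsilon> * (t / h + 1)"
  proof (rule excursion_bound[where d = "\<lambda>t. x t - y t"])
    fix a b assume ab: "0 \<le> a" "a < b" "b - a \<le> h" and pos: "\<And>r. a < r \<Longrightarrow> r < b \<Longrightarrow> x r - y r > 0"
    obtain s where s: "a < s" "s < b" and "y b - y a = (b - a) * slope (y s) s"
      using half_line_solution_mvt[OF y ab(1,2)] by blast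
    moreover have "(b - a) * slope (x s) s \<le> (b - a) * slope (y s) s"
      using ab s pos[of s] by (intro mult_left_mono slope_antimono) auto
    moreover have "\<bar>x b - x a - (b - a) * slope (x s) s\<bar> \<le> (4 + 6 * B) * \<epsilon>"
      using window_estimate[OF x \<epsilon>, of a s b] ab s by (simp add: h_def mult.commute)
    ultimately show "(x b - y b) - (x a - y a) \<le> (4 + 6 * B) * \<epsilon>"
      by linarith
  qed (use h e t \<open>x 0 = y 0\<close> in \<open>auto intro!: continuous_intros cont\<close>)
  moreover have "y t - x t \<le> (4 + 6 * B) * \<epsilon> * (t / h + 1)"
  proof (rule excursion_bound[where d = "\<lambda>t. y t - x t"])
    fix a b assume ab: "0 \<le> a" "a < b" "b - a \<le> h" and pos: "\<And>r. a < r \<Longrightarrow> r < b \<Longrightarrow> y r - x r > 0"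
    obtain s where s: "a < s" "s < b" and "y b - y a = (b - a) * slope (y s) s"
      using half_line_solution_mvt[OF y ab(1,2)] by blast
    moreover have "(b - a) * slope (y s) s \<le> (b - a) * slope (x s) s"
      using ab s pos[of s] by (intro mult_left_mono slope_antimono) auto
    moreover have "\<bar>x b - x a - (b - a) * slope (x s) s\<bar> \<le> (4 + 6 * B) * \<epsilon>"
      using window_estimate[OF x \<epsilon>, of a s b] ab s by (simp add: h_def mult.commute)
    ultimately show "(y b - x b) - (y a - x a) \<le> (4 + 6 * B) * \<epsilon>"
      by linarith
  qed (use h e t \<open>x 0 = y 0\<close> in \<open>auto intro!: continuous_intros cont\<close>)
  ultimately show ?thesis
    unfolding h_def[symmetric] by (simp add: abs_le_iff)
qed

end

section \<open>Essential suprema of continuous functions, and the final constants\<close>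

lemma abs_le_Linf_norm:
  fixes f :: "'a::euclidean_space \<Rightarrow> real"
  assumes cont: "continuous_on UNIV f"
  shows "ereal \<bar>f x\<bar> \<le> Linf_norm UNIV f"
proof -
  define N where "N = Linf_norm UNIV f"
  have "AE x in lebesgue. ereal \<bar>f x\<bar> \<le> N"
    unfolding N_def Linf_norm_def
    using esssup_AE[where M = lebesgue and f = "\<lambda>x. ereal \<bar>f x\<bar>"] by (simp add: lebesgue_on_UNIV_eq)
  \<comment> \<open>A closed set of full Lebesgue measure is the whole space, which turns the almost
    everywhere bound into a pointwise one.\<close>
  moreover have "closed {x. ereal \<bar>f x\<bar> \<le> N}"
    using cont by (intro closed_Collect_le continuous_intros)
  ultimately show ?thesis
    using mem_closed_if_AE_lebesgue[of "{x. ereal \<bar>f x\<bar> \<le> N}" x] by (simp add: N_def)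
qed

lemma Linf_norm_le:
  assumes "continuous_on S f" "S \<in> sets lebesgue" and "\<And>x. x \<in> S \<Longrightarrow> \<bar>f x\<bar> \<le> c"
  shows "Linf_norm S f \<le> ereal c"
  unfolding Linf_norm_def
proof (rule esssup_I)
  have "f \<in> borel_measurable (lebesgue_on S)"
    using assms(1,2) by (rule continuous_imp_measurable_on_sets_lebesgue)
  then show "(\<lambda>x. ereal \<bar>f x\<bar>) \<in> borel_measurable (lebesgue_on S)"
    by measurable
  show "AE x in lebesgue_on S. ereal \<bar>f x\<bar> \<le> ereal c"
    using assms(3) by (intro AE_I2) (auto simp: space_restrict_space)
qed

lemma dist_Pair_le: "dist (a, b) (c, d) \<le> dist a c + dist b d"
  by (simp add: dist_Pair_Pair sqrt_sum_squares_le_sum)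

text \<open>The Euclidean distance is at most the sum of coordinate distances;
  \<open>\<alpha> + 1\<close> replaces \<open>\<alpha>\<close> to meet the requirement of a constant
  at least 1.\<close>

lemma oscillating_fieldI:
  fixes f :: "real \<times> real \<times> real \<times> real \<Rightarrow> real"
  assumes lip: "\<alpha>-lipschitz_on UNIV f" and "\<alpha> \<ge> 0" and norm: "Linf_norm UNIV f = ereal \<beta>"
    and "\<And>v \<tau> u t l k. f (v + of_int l, \<tau> + of_int k, u, t) = f (v, \<tau>, u, t)"
    and "\<And>v \<tau> t. antimono (\<lambda>u. f (v, \<tau>, u, t))"
  shows "oscillating_field f (\<alpha> + 1) \<beta>"
proof
  show "1 \<le> \<alpha> + 1" using \<open>\<alpha> \<ge> 0\<close> by simp
  show cont: "continuous_on UNIV f"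
    using lip by (rule lipschitz_on_continuous_on)
  show "\<bar>f p\<bar> \<le> \<beta>" for p
    using abs_le_Linf_norm[OF cont, of p] by (simp add: norm)
  fix v \<tau> u t v' \<tau>' u' t' :: real
  have "\<bar>f (v, \<tau>, u, t) - f (v', \<tau>', u', t')\<bar> \<le> \<alpha> * dist (v, \<tau>, u, t) (v', \<tau>', u', t')"
    using lipschitz_onD[OF lip, of "(v, \<tau>, u, t)" "(v', \<tau>', u', t')"] by (simp add: dist_real_def)
  also have "\<dots> \<le> (\<alpha> + 1) * (\<bar>v - v'\<bar> + \<bar>\<tau> - \<tau>'\<bar> + \<bar>u - u'\<bar> + \<bar>t - t'\<bar>)"
  proof (rule mult_mono)
    show "dist (v, \<tau>, u, t) (v', \<tau>', u', t') \<le> \<bar>v - v'\<bar> + \<bar>\<tau> - \<tau>'\<bar> + \<bar>u - u'\<bar> + \<bar>t - t'\<bar>"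
      using dist_Pair_le[of v "(\<tau>, u, t)" v' "(\<tau>', u', t')"]
        dist_Pair_le[of \<tau> "(u, t)" \<tau>' "(u', t')"] dist_Pair_le[of u t u' t']
      by (simp add: dist_real_def)
  qed (use \<open>\<alpha> \<ge> 0\<close> in auto)
  finally show "\<bar>f (v, \<tau>, u, t) - f (v', \<tau>', u', t')\<bar>
      \<le> (\<alpha> + 1) * (\<bar>v - v'\<bar> + \<bar>\<tau> - \<tau>'\<bar> + \<bar>u - u'\<bar> + \<bar>t - t'\<bar>)" .
qed (fact assms)+

theorem theorem1p5:
  fixes \<alpha> \<beta> C :: real
  assumes "\<alpha> \<ge> 0" and "\<beta> \<ge> 0" and "C > 0"
  shows "\<exists>c>0. \<forall>f :: real \<times> real \<times> real \<times> real \<Rightarrow> real.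
     bounded (range f) \<and> \<alpha>-lipschitz_on UNIV f \<and> Linf_norm UNIV f = ereal \<beta> \<longrightarrow>
     (\<forall>v \<tau> u t. \<forall>l k :: int. f (v + of_int l, \<tau> + of_int k, u, t) = f (v, \<tau>, u, t)) \<longrightarrow>
     (\<forall>v \<tau> t. antimono (\<lambda>u. f (v, \<tau>, u, t))) \<longrightarrow>
     (\<forall>(u0 :: real) (\<epsilon> :: real) (u\<epsilon> :: real \<Rightarrow> real) (uhom :: real \<Rightarrow> real).
        0 < \<epsilon> \<and> \<epsilon> < 1 \<and>
        solves_cauchy (\<lambda>u t. f (u / \<epsilon>, t / \<epsilon>, u, t)) u0 u\<epsilon> \<and>
        solves_cauchy (effective_slope f) u0 uhom \<longrightarrow>
        (\<forall>T \<ge> C * \<epsilon> * \<bar>ln \<epsilon>\<bar>.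
           Linf_norm {0<..<T} (\<lambda>t. u\<epsilon> t - uhom t) \<le> ereal (c * T / \<bar>ln \<epsilon>\<bar>)))"
\<comment> \<open>\<open>4 + 6 * \<beta>\<close> is the error per window in units of
  \<open>\<epsilon>\<close>, \<open>2 * (\<alpha> + 1)\<close> comes from the window length, and
  \<open>1 / C\<close> pays for the incomplete window.\<close>
proof (intro exI[of _ "(4 + 6 * \<beta>) * (2 * (\<alpha> + 1) + 1 / C)"] conjI allI impI)
  show "0 < (4 + 6 * \<beta>) * (2 * (\<alpha> + 1) + 1 / C)"
    using assms by (intro mult_pos_pos add_pos_nonneg[of 4] add_nonneg_pos) auto
  fix f :: "real \<times> real \<times> real \<times> real \<Rightarrow> real" and u0 \<epsilon> T :: real and u\<epsilon> uhom :: "real \<Rightarrow> real"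
  assume regular: "bounded (range f) \<and> \<alpha>-lipschitz_on UNIV f \<and> Linf_norm UNIV f = ereal \<beta>"
    and periodic: "\<forall>v \<tau> u t. \<forall>l k :: int. f (v + of_int l, \<tau> + of_int k, u, t) = f (v, \<tau>, u, t)"
    and antimono: "\<forall>v \<tau> t. antimono (\<lambda>u. f (v, \<tau>, u, t))"
    and solutions: "0 < \<epsilon> \<and> \<epsilon> < 1 \<and>
        solves_cauchy (\<lambda>u t. f (u / \<epsilon>, t / \<epsilon>, u, t)) u0 u\<epsilon> \<and>
        solves_cauchy (effective_slope f) u0 uhom"
    and T: "C * \<epsilon> * \<bar>ln \<epsilon>\<bar> \<le> T"
  interpret oscillating_field f "\<alpha> + 1" \<beta>
    using regular periodic antimono \<open>\<alpha> \<ge> 0\<close> by (intro oscillating_fieldI) auto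
  have \<epsilon>: "0 < \<epsilon>" "\<epsilon> < 1" using solutions by auto
  define l where "l = \<bar>ln \<epsilon>\<bar>"
  have l: "0 < l" "- ln \<epsilon> = l" using \<epsilon> by (auto simp: l_def)
  have sol: "half_line_solution (\<lambda>u t. f (u / \<epsilon>, t / \<epsilon>, u, t)) u\<epsilon>" "half_line_solution slope uhom"
    using solutions solves_cauchy_imp_half_line_solution by blast+
  have start: "u\<epsilon> 0 = uhom 0" using solutions by (simp add: solves_cauchy_def)
  show "Linf_norm {0<..<T} (\<lambda>t. u\<epsilon> t - uhom t)
      \<le> ereal ((4 + 6 * \<beta>) * (2 * (\<alpha> + 1) + 1 / C) * T / \<bar>ln \<epsilon>\<bar>)"
  proof (rule Linf_norm_le)
    show "continuous_on {0<..<T} (\<lambda>t. u\<epsilon> t - uhom t)"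
      by (intro continuous_intros half_line_solution_continuous_on[OF sol(1)]
          half_line_solution_continuous_on[OF sol(2)]) auto
    fix t assume "t \<in> {0<..<T}"
    then have t: "0 \<le> t" "t \<le> T" by auto
    have "\<bar>u\<epsilon> t - uhom t\<bar> \<le> (4 + 6 * \<beta>) * \<epsilon> * (t / (\<epsilon> * (l / (2 * (\<alpha> + 1)))) + 1)"
      using homogenization_error[OF sol start \<epsilon> t(1)] unfolding l .
    also have "\<dots> = (4 + 6 * \<beta>) * (2 * (\<alpha> + 1) * t / l + \<epsilon>)"
      using \<epsilon> l by (simp add: field_simps)
    also have "\<dots> \<le> (4 + 6 * \<beta>) * (2 * (\<alpha> + 1) * T / l + T / (C * l))"
    proof (intro mult_left_mono add_mono divide_right_mono)
      \<comment> \<open>This is the lower bound on \<open>T\<close>, solved for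
        \<open>\<epsilon>\<close>.\<close>
      show "\<epsilon> \<le> T / (C * l)"
        using T l \<open>C > 0\<close> by (simp add: l_def[symmetric] field_simps)
    qed (use t l assms in auto)
    also have "\<dots> = (4 + 6 * \<beta>) * (2 * (\<alpha> + 1) + 1 / C) * T / l"
      using l \<open>C > 0\<close> by (simp add: field_simps)
    finally show "\<bar>u\<epsilon> t - uhom t\<bar> \<le> (4 + 6 * \<beta>) * (2 * (\<alpha> + 1) + 1 / C) * T / \<bar>ln \<epsilon>\<bar>"
      by (simp add: l_def)
  qed simp
qed

end
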